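(* Let $\mathcal{H}$ be a complex Hilbert space, $A\in\mathcal{B}(\mathcal{H})$ a positive operator, and $T_1,T_2,S_1,S_2\in\mathcal{B}_{A^{1/2}}(\mathcal{H})$. Put $$a_2=\frac12\left[\omega_A(S_1T_1)+\omega_A(S_2T_2)+\sqrt{\left(\omega_A(S_1T_1)-\omega_A(S_2T_2)\right)^2+4\|S_1T_2\|_A\|S_2T_1\|_A}\right].$$ Then $r_A(T_1S_1+T_2S_2)\leq a_2$. Moreover, $a_2\le a_1$, where $$a_1=\frac12\left[\|S_1T_1\|_A+\|S_2T_2\|_A+\sqrt{\left(\|S_1T_1\|_A-\|S_2T_2\|_A\right)^2+4\|S_1T_2\|_A\|S_2T_1\|_A}\right].$$
   Context: $\mathcal{B}(\mathcal{H})$ is the algebra of bounded linear operators on the complex Hilbert space $(\mathcal{H},\langle\cdot\mid\cdot\rangle)$. For positive $A$, put $\langle x\mid y\rangle_A=\langle Ax\mid y\rangle$ and $\|x\|_A=\langle x\mid x\rangle_A^{1/2}=\|A^{1/2}x\|$. $\mathcal{B}_{A^{1/2}}(\mathcal{H})$ is the set of $T\in\mathcal{B}(\mathcal{H})$ for which there is $\lambda>0$ with $\|Tx\|_A\le\lambda\|x\|_A$ for all $x\in\mathcal{H}$ ($A$-bounded operators). For such $T$, $\|T\|_A=\sup\{\|Tx\|_A: x\in\mathcal{H},\ \|x\|_A=1\}$, the $A$-numerical radius is $\omega_A(T)=\sup\{|\langle Tx\mid x\rangle_A|: x\in\mathcal{H},\ \|x\|_A=1\}$ (suprema over the empty set,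 occurring only if $A=0$, are $0$), and the $A$-spectral radius is $r_A(T)=\inf_{n\ge1}\|T^n\|_A^{1/n}=\lim_{n\to\infty}\|T^n\|_A^{1/n}$. *)

theory Defs
  imports "HOL-Analysis.Analysis"
begin

class complex_vector = real_vector +
  fixes scaleC :: "complex \<Rightarrow> 'a \<Rightarrow> 'a"  (infixr \<open>*\<^sub>C\<close> 75)
  assumes scaleC_add_right: "c *\<^sub>C (x + y) = c *\<^sub>C x + c *\<^sub>C y"
    and scaleC_add_left: "(c + d) *\<^sub>C x = c *\<^sub>C x + d *\<^sub>C x"
    and scaleC_scaleC: "c *\<^sub>C d *\<^sub>C x = (c * d) *\<^sub>C x"
    and scaleC_one: "1 *\<^sub>C x = x"
    and scaleR_scaleC: "r *\<^sub>R x = complex_of_real r *\<^sub>C x"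

text \<open>The inner product is linear in the first argument.\<close>

class complex_inner = complex_vector + real_normed_vector +
  fixes cinner :: "'a \<Rightarrow> 'a \<Rightarrow> complex"
  assumes cinner_commute: "cinner x y = cnj (cinner y x)"
    and cinner_add_left: "cinner (x + y) z = cinner x z + cinner y z"
    and cinner_scaleC_left: "cinner (c *\<^sub>C x) y = c * cinner x y"
    and cinner_self_nonneg: "cinner x x \<in> \<real>\<^sub>\<ge>\<^sub>0"
    and cinner_self_eq_zero_iff: "cinner x x = 0 \<longleftrightarrow> x = 0"
    and norm_eq_sqrt_cinner: "norm x = sqrt (Re (cinner x x))"

class chilbert_space = complex_inner + complete_space

instantiation complex :: chilbert_space
begin

definition scaleC_complex :: "complex \<Rightarrow> complex \<Rightarrow> complex"
  where "scaleC_complex c x = c * x"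

definition cinner_complex :: "complex \<Rightarrow> complex \<Rightarrow> complex"
  where "cinner_complex x y = x * cnj y"

instance
proof
  fix c d x y z :: complex and r :: real
  show "cinner x x \<in> \<real>\<^sub>\<ge>\<^sub>0"
    by (simp add: cinner_complex_def complex_nonneg_Reals_iff)
  show "norm x = sqrt (Re (cinner x x))"
    by (simp add: cinner_complex_def cmod_def power2_eq_square)
qed (simp_all add: scaleC_complex_def cinner_complex_def algebra_simps scaleR_conv_of_real)

end

definition bounded_clinear :: "('a::complex_inner \<Rightarrow> 'a) \<Rightarrow> bool"
  where "bounded_clinear T \<longleftrightarrow> bounded_linear T \<and> (\<forall>c x. T (c *\<^sub>C x) = c *\<^sub>C T x)"

definition positive_op :: "('a::complex_inner \<Rightarrow> 'a) \<Rightarrow> bool"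
  where "positive_op A \<longleftrightarrow> bounded_clinear A \<and> (\<forall>x. cinner (A x) x \<in> \<real>\<^sub>\<ge>\<^sub>0)"

definition A_inner :: "('a::complex_inner \<Rightarrow> 'a) \<Rightarrow> 'a \<Rightarrow> 'a \<Rightarrow> complex"
  where "A_inner A x y = cinner (A x) y"

definition A_norm :: "('a::complex_inner \<Rightarrow> 'a) \<Rightarrow> 'a \<Rightarrow> real"
  where "A_norm A x = sqrt (Re (A_inner A x x))"

definition A_bounded_ops :: "('a::complex_inner \<Rightarrow> 'a) \<Rightarrow> ('a \<Rightarrow> 'a) set"
  where "A_bounded_ops A =
    {T. bounded_clinear T \<and> (\<exists>l>0. \<forall>x. A_norm A (T x) \<le> l * A_norm A x)}"

text \<open>On \<open>real\<close> the library leaves \<open>Sup {}\<close> unspecified, whereas here the supremum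
  of the empty set (no \<open>A\<close>-unit vectors, i.e. \<open>A = 0\<close>) is taken to be \<open>0\<close>.\<close>

definition Sup0 :: "real set \<Rightarrow> real"
  where "Sup0 X = (if X = {} then 0 else Sup X)"

definition A_opnorm :: "('a::complex_inner \<Rightarrow> 'a) \<Rightarrow> ('a \<Rightarrow> 'a) \<Rightarrow> real"
  where "A_opnorm A T = Sup0 {A_norm A (T x) | x. A_norm A x = 1}"

definition A_numerical_radius :: "('a::complex_inner \<Rightarrow> 'a) \<Rightarrow> ('a \<Rightarrow> 'a) \<Rightarrow> real"
  where "A_numerical_radius A T = Sup0 {cmod (A_inner A (T x) x) | x. A_norm A x = 1}"

definition A_spectral_radius :: "('a::complex_inner \<Rightarrow> 'a) \<Rightarrow> ('a \<Rightarrow> 'a) \<Rightarrow> real"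
  where "A_spectral_radius A T = (INF n\<in>{1..}. root n (A_opnorm A (T ^^ n)))"

end

theory Submission imports Defs
begin

text \<open>
  With \<open>C x = (S1 x, S2 x)\<close> and \<open>R (x, y) = T1 x + T2 y\<close>, the operator \<open>T1 S1 + T2 S2\<close> is \<open>R C\<close>,
  so its powers are \<open>R M\<^sup>n C\<close> for the block operator \<open>M = C R\<close> on pairs.  The growth of \<open>M\<^sup>n\<close> is
  controlled by the numerical radius of \<open>M\<close>, through the power inequality and polarization.
  That numerical radius is taken with respect to the form
  \<open>c \<langle>x, u\<rangle>\<^sub>A + b \<langle>y, v\<rangle>\<^sub>A\<close> with \<open>b, c\<close> slightly larger than the norms of \<open>S1 T2\<close> and \<open>S2 T1\<close>;
  this weight makes the two off-diagonal blocks contribute their geometric mean.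
\<close>

section \<open>Positive semidefinite sesquilinear forms\<close>

text \<open>The form may be degenerate, so \<open>sqnorm\<close> is only the square of a seminorm.
  The locale serves twice: for \<open>A_inner A\<close>, and for a weighted form on pairs. Hermitian
  symmetry is derived from positivity.\<close>

locale psd_form =
  fixes q :: "'b::complex_vector \<Rightarrow> 'b \<Rightarrow> complex"
  assumes add_left: "q (x + y) z = q x z + q y z"
    and add_right: "q x (y + z) = q x y + q x z"
    and scale_left: "q (c *\<^sub>C x) y = c * q x y"
    and scale_right: "q x (c *\<^sub>C y) = cnj c * q x y"
    and nonneg: "q x x \<in> \<real>\<^sub>\<ge>\<^sub>0"
begin

definition sqnorm :: "'b \<Rightarrow> real"
  where "sqnorm x = Re (q x x)"

lemma self_eq: "q x x = complex_of_real (sqnorm x)"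
  using nonneg[of x] by (auto simp: sqnorm_def complex_nonneg_Reals_iff complex_eq_iff)

lemma sqnorm_nonneg: "0 \<le> sqnorm x"
  using nonneg[of x] by (auto simp: sqnorm_def complex_nonneg_Reals_iff)

lemma zero_right [simp]: "q x 0 = 0"
  using add_right[of x 0 0] by simp

lemma sum_right: "q x (\<Sum>i\<in>I. f i) = (\<Sum>i\<in>I. q x (f i))"
  by (induction I rule: infinite_finite_induct) (auto simp: add_right)

lemma minus_left: "q (x - y) z = q x z - q y z"
  using add_left[of "x - y" y z] by simp

lemma sqnorm_scale: "sqnorm (c *\<^sub>C x) = (cmod c)\<^sup>2 * sqnorm x"
proof -
  have "q (c *\<^sub>C x) (c *\<^sub>C x) = complex_of_real ((cmod c)\<^sup>2) * q x x"
    by (simp add: scale_left scale_right complex_norm_square mult_ac del: of_real_power)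
  then show ?thesis by (simp add: sqnorm_def)
qed

lemma sqnorm_add: "sqnorm (x + y) = sqnorm x + sqnorm y + Re (q x y) + Re (q y x)"
  by (simp add: sqnorm_def add_left add_right)

text \<open>Polarization: \<open>q\<close> is real on the diagonal, so evaluation at
  \<open>x + y\<close> relates the imaginary parts and evaluation at
  \<open>x + \<i> *\<^sub>C y\<close> the real parts.\<close>

lemma hermitian: "q y x = cnj (q x y)"
proof -
  have "Im (q (x + y) (x + y)) = 0" "Im (q (x + \<i> *\<^sub>C y) (x + \<i> *\<^sub>C y)) = 0"
    by (simp_all add: self_eq)
  moreover have "Im (q x x) = 0" "Im (q y y) = 0"
    by (simp_all add: self_eq)
  ultimately show ?thesis
    by (simp add: add_left add_right scale_left scale_right complex_eq_iff)
qed

text \<open>Expanding the square of \<open>x\<close> minus \<open>t * q x y\<close> times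
  \<open>y\<close> gives a nonnegative quadratic in the real number \<open>t\<close>. Its value at
  \<open>1 / sqnorm y\<close> is the claim; if \<open>sqnorm y = 0\<close>, it is linear in
  \<open>t\<close>, which forces \<open>m = 0\<close>.\<close>

lemma cauchy_schwarz: "(cmod (q x y))\<^sup>2 \<le> sqnorm x * sqnorm y"
proof -
  define m where "m = (cmod (q x y))\<^sup>2"
  have quad: "0 \<le> sqnorm x - 2 * t * m + t\<^sup>2 * m * sqnorm y" for t :: real
  proof -
    define d where "d = - (complex_of_real t * q x y)"
    have cm: "q x y * cnj (q x y) = complex_of_real m"
      by (simp add: m_def complex_norm_square del: of_real_power)
    have a: "q x (d *\<^sub>C y) = - complex_of_real (t * m)"
      by (simp add: scale_right d_def flip: cm)
    have b: "q (d *\<^sub>C y) x = - complex_of_real (t * m)"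
      by (simp add: hermitian[of "d *\<^sub>C y"] a)
    have c: "(cmod d)\<^sup>2 = t\<^sup>2 * m"
      by (simp add: d_def m_def norm_mult power_mult_distrib)
    have "0 \<le> sqnorm (x + d *\<^sub>C y)" by (rule sqnorm_nonneg)
    then show ?thesis
      by (simp add: sqnorm_add a b sqnorm_scale c algebra_simps)
  qed
  show ?thesis
  proof (cases "sqnorm y = 0")
    case True
    have "m = 0"
    proof (rule ccontr)
      assume "m \<noteq> 0"
      \<comment> \<open>With this \<open>t\<close> the linear expression equals -1.\<close>
      then show False
        using quad[of "(sqnorm x + 1) / (2 * m)"] sqnorm_nonneg[of x] True by (simp add: field_simps)
    qed
    then show ?thesis using True by (simp add: m_def)
  next
    case False
    then have "0 < sqnorm y" using sqnorm_nonneg[of y] by simp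
    then have "0 \<le> sqnorm x - m / sqnorm y"
      using quad[of "1 / sqnorm y"] by (simp add: field_simps power2_eq_square)
    with \<open>0 < sqnorm y\<close> show ?thesis by (simp add: m_def field_simps)
  qed
qed

lemma cauchy_schwarz_sqrt: "cmod (q x y) \<le> sqrt (sqnorm x) * sqrt (sqnorm y)"
  using cauchy_schwarz[of x y] by (simp add: real_le_rsqrt flip: real_sqrt_mult)

lemma sqnorm_add_le: "sqnorm (x + y) \<le> 2 * sqnorm x + 2 * sqnorm y"
proof -
  have "0 \<le> sqnorm (x + (-1) *\<^sub>C y)" by (rule sqnorm_nonneg)
  then have "Re (q x y) + Re (q y x) \<le> sqnorm x + sqnorm y"
    by (simp add: sqnorm_add sqnorm_scale scale_left scale_right)
  then show ?thesis by (simp add: sqnorm_add)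
qed

end

section \<open>Finite sums and complex-linear maps\<close>

lemma scaleC_sum_right: "c *\<^sub>C (\<Sum>i\<in>I. f i) = (\<Sum>i\<in>I. c *\<^sub>C (f i :: 'a::complex_vector))"
proof (induction I rule: infinite_finite_induct)
  case (insert i I) then show ?case by (simp add: scaleC_add_right)
qed (use scaleC_add_right[of c "0::'a" 0] in auto)

lemma scaleC_zero_left: "0 *\<^sub>C (x :: 'a::complex_vector) = 0"
  using scaleC_add_left[of 0 0 x] by simp

lemma scaleC_sum_left: "(\<Sum>i\<in>I. f i) *\<^sub>C (x :: 'a::complex_vector) = (\<Sum>i\<in>I. f i *\<^sub>C x)"
  by (induction I rule: infinite_finite_induct) (auto simp: scaleC_add_left scaleC_zero_left)

text \<open>Algebraic linearity only, so that it applies to operators on pairs as well; their size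
  is measured through a form.\<close>

definition complex_linear :: "('a::complex_vector \<Rightarrow> 'a) \<Rightarrow> bool"
  where "complex_linear T \<longleftrightarrow> (\<forall>x y. T (x + y) = T x + T y) \<and> (\<forall>c x. T (c *\<^sub>C x) = c *\<^sub>C T x)"

lemma complex_linear_sum:
  assumes "complex_linear T"
  shows "T (\<Sum>i\<in>I. f i) = (\<Sum>i\<in>I. T (f i))"
proof -
  have "T 0 = 0"
    using assms unfolding complex_linear_def by (metis add_cancel_right_left)
  then show ?thesis
    using assms unfolding complex_linear_def
    by (induction I rule: infinite_finite_induct) auto
qed

lemma complex_linear_funpow: "complex_linear T \<Longrightarrow> complex_linear (T ^^ n)"
  by (induction n) (auto simp: complex_linear_def)

section \<open>The power inequality\<close>

lemma cis_divide_power: "0 < n \<Longrightarrow> cis (a / real n) ^ n = cis a"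
  unfolding Complex.DeMoivre by simp

text \<open>The terms form a geometric progression whose ratio is an \<open>n\<close>-th root of
  unity; the ratio is not 1 because \<open>n\<close> does not divide \<open>m\<close>.\<close>

lemma sum_powers_of_root_of_unity:
  fixes n m :: nat
  assumes "0 < m" "m < n"
  shows "(\<Sum>j<n. cis (2 * pi * j / n) ^ m) = 0"
proof -
  define r where "r = cis (2 * pi * m / n)"
  have "r \<noteq> 1"
  proof
    assume "r = 1"
    then have "cos (2 * pi * m / n) = 1" by (simp add: r_def complex_eq_iff)
    then obtain k :: int where "2 * pi * m / n = k * (2 * pi)"
      using cos_one_2pi_int by auto
    then have "real m = k * real n" using assms by (simp add: field_simps)
    then have "int m = k * int n" by (metis of_int_eq_iff of_int_mult of_int_of_nat_eq)
    then have "n dvd m" by (metis dvd_triv_right int_dvd_int_iff)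
    then show False using assms by (auto dest: dvd_imp_le)
  qed
  moreover have "r ^ n = 1"
    using assms by (simp add: r_def cis_divide_power cis_multiple_2pi)
  moreover have "cis (2 * pi * j / n) ^ m = r ^ j" for j
    unfolding r_def Complex.DeMoivre by (simp add: mult_ac)
  ultimately show ?thesis by (simp add: sum_gp_strict)
qed

context psd_form
begin

text \<open>
  Pearcy's argument: if \<open>\<zeta>\<close> ranges over the \<open>n\<close>-th roots of unity, the geometric sums
  \<open>x\<^sub>\<zeta> = (1/n) \<Sum>\<^sub>m (z\<zeta>)\<^sup>m T\<^sup>m x\<close> add up to \<open>x\<close>, while \<open>(1 - z\<zeta>T) x\<^sub>\<zeta> = (1/n) (1 - z\<^sup>n T\<^sup>n) x\<close>
  does not depend on \<open>\<zeta>\<close>.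
\<close>

lemma Re_power_le:
  assumes T: "complex_linear T" and n: "0 < n"
    and w: "\<And>y. cmod (q (T y) y) \<le> w * sqnorm y"
    and z: "cmod z * w \<le> 1"
  shows "Re (z ^ n * q ((T ^^ n) x) x) \<le> sqnorm x"
proof -
  define r where "r j = z * cis (2 * pi * real j / real n)" for j :: nat
  define g where "g j m = (r j ^ m / of_nat n) *\<^sub>C (T ^^ m) x" for j m
  define X where "X j = (\<Sum>m<n. g j m)" for j
  \<comment> \<open>The root of unity disappears in the \<open>n\<close>-th power, which makes
    \<open>g j n\<close>, and hence \<open>d\<close> below, independent of \<open>j\<close>.\<close>
  have rn: "r j ^ n = z ^ n" for j
    using n by (simp add: r_def power_mult_distrib cis_divide_power cis_multiple_2pi)
  have sum_X: "(\<Sum>j<n. X j) = x"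
  proof -
    \<comment> \<open>Averaging over the roots of unity leaves only the constant
      coefficient.\<close>
    have "(\<Sum>j<n. r j ^ m / of_nat n) = (if m = 0 then 1 else 0)" if "m < n" for m
    proof -
      have "(\<Sum>j<n. r j ^ m / of_nat n) = z ^ m * (\<Sum>j<n. cis (2 * pi * real j / real n) ^ m) / of_nat n"
        by (simp add: r_def power_mult_distrib sum_divide_distrib sum_distrib_left)
      then show ?thesis
        using n that sum_powers_of_root_of_unity[of m n] by auto
    qed
    moreover have "(\<Sum>j<n. X j) = (\<Sum>m<n. (\<Sum>j<n. r j ^ m / of_nat n) *\<^sub>C (T ^^ m) x)"
      by (simp add: X_def g_def scaleC_sum_left) (rule sum.swap)
    ultimately have "(\<Sum>j<n. X j) = (\<Sum>m<n. (if m = 0 then 1 else 0) *\<^sub>C (T ^^ m) x)"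
      by simp
    also have "\<dots> = (\<Sum>m<n. if m = 0 then x else 0)"
      by (rule sum.cong) (auto simp: scaleC_one scaleC_zero_left)
    finally show ?thesis using n by simp
  qed
  have tele: "X j - r j *\<^sub>C T (X j) = g j 0 - g j n" for j
  proof -
    have "r j *\<^sub>C T (g j m) = g j (Suc m)" for m
      using T by (simp add: g_def complex_linear_def scaleC_scaleC)
    then have "r j *\<^sub>C T (X j) = (\<Sum>m<n. g j (Suc m))"
      by (simp add: X_def complex_linear_sum[OF T] scaleC_sum_right)
    then show ?thesis
      by (simp add: X_def sum_lessThan_telescope' flip: sum_subtractf)
  qed
  define d where "d = (1 / of_nat n) *\<^sub>C x - (z ^ n / of_nat n) *\<^sub>C (T ^^ n) x"
  have d: "g j 0 - g j n = d" for j
    by (simp add: g_def d_def rn)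
  \<comment> \<open>By \<open>tele\<close>, \<open>d\<close> is
    \<open>X j - r j *\<^sub>C T (X j)\<close>. Since \<open>r j\<close> has the modulus of
    \<open>z\<close>, the bounds \<open>w\<close> and \<open>z\<close> keep the subtracted term
    below \<open>sqnorm (X j)\<close>.\<close>
  have "0 \<le> Re (q d (X j))" for j
  proof -
    have "cmod (q (r j *\<^sub>C T (X j)) (X j)) \<le> cmod z * (w * sqnorm (X j))"
      by (simp add: scale_left norm_mult r_def mult_left_mono w)
    also have "\<dots> \<le> sqnorm (X j)"
      using mult_right_mono[OF z sqnorm_nonneg[of "X j"]] by (simp add: mult.assoc)
    finally have "Re (q (r j *\<^sub>C T (X j)) (X j)) \<le> sqnorm (X j)"
      using complex_Re_le_cmod order_trans by blast
    then show ?thesis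
      by (simp add: minus_left sqnorm_def flip: d[of j] tele)
  qed
  \<comment> \<open>As \<open>d\<close> is the same for all \<open>j\<close>, the sum moves into the
    second argument, where the \<open>X j\<close> add up to \<open>x\<close>.\<close>
  then have "0 \<le> (\<Sum>j<n. Re (q d (X j)))"
    by (intro sum_nonneg) auto
  also have "\<dots> = Re (q d x)"
    by (simp add: sum_right flip: Re_sum sum_X)
  also have "\<dots> = (sqnorm x - Re (z ^ n * q ((T ^^ n) x) x)) / n"
    by (simp add: d_def minus_left scale_left sqnorm_def diff_divide_distrib)
  finally show ?thesis
    using n by (simp add: zero_le_divide_iff)
qed

text \<open>Berger's power inequality. In \<open>Re_power_le\<close>, \<open>z\<close> is chosen of
  modulus \<open>1 / w\<close> and with the argument that rotates \<open>z ^ n * v\<close> onto the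
  nonnegative real axis, so that the real part there is the full modulus.\<close>

lemma power_inequality:
  assumes T: "complex_linear T" and w: "0 < w"
    and bound: "\<And>y. cmod (q (T y) y) \<le> w * sqnorm y"
  shows "cmod (q ((T ^^ n) x) x) \<le> w ^ n * sqnorm x"
proof (cases "n = 0")
  case True
  then show ?thesis by (simp add: self_eq sqnorm_nonneg)
next
  case False
  define v where "v = q ((T ^^ n) x) x"
  define z where "z = complex_of_real (1 / w) * cis (- Arg v / n)"
  have "z ^ n * v = complex_of_real (1 / w ^ n) * (cis (- Arg v) * v)"
    using False cis_divide_power[of n "- Arg v"]
    by (simp add: z_def power_mult_distrib power_divide)
  also have "cis (- Arg v) * v = complex_of_real (cmod v)"
    by (metis Arg_def cis_mult cis_zero add.left_inverse mult.left_commute mult.right_neutral rcis_cmod_Arg rcis_def)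
  finally have "Re (z ^ n * v) = cmod v / w ^ n" by simp
  moreover have "Re (z ^ n * v) \<le> sqnorm x"
    unfolding v_def using False w by (intro Re_power_le[OF T _ bound]) (auto simp: z_def norm_mult norm_divide)
  ultimately have "cmod v / w ^ n \<le> sqnorm x" by simp
  then show ?thesis
    using w by (simp add: field_simps flip: v_def)
qed

text \<open>The norm is at most twice the numerical radius: polarization recovers
  \<open>q (T x) y\<close> from four values of the quadratic form of \<open>T\<close>, and
  \<open>y\<close> is taken proportional to \<open>T x\<close>.\<close>

lemma sqnorm_le_of_numerical_bound:
  assumes T: "complex_linear T" and w: "0 < w"
    and bound: "\<And>y. cmod (q (T y) y) \<le> w * sqnorm y"
  shows "sqnorm (T x) \<le> 4 * w\<^sup>2 * sqnorm x"
proof -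
  \<comment> \<open>The estimate will read
    \<open>(t - w * t\<^sup>2) * sqnorm (T x) \<le> w * sqnorm x\<close>; this \<open>t\<close>
    maximizes the factor on the left.\<close>
  define t where "t = 1 / (2 * w)"
  define y where "y = complex_of_real t *\<^sub>C T x"
  define f where "f d = d * q (T (x + d *\<^sub>C y)) (x + d *\<^sub>C y)" for d
  have T': "T (u + v) = T u + T v" "T (c *\<^sub>C u) = c *\<^sub>C T u" for u v c
    using T by (auto simp: complex_linear_def)
  have fle: "cmod (f d) \<le> w * sqnorm (x + d *\<^sub>C y)" if "cmod d = 1" for d
    using bound that by (simp add: f_def norm_mult)
  \<comment> \<open>The factor \<open>d\<close> cancels the conjugate in the term with
    \<open>q (T x) y\<close>; the other terms carry \<open>d\<close> or \<open>d\<^sup>2\<close>,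
    which sum to zero over the fourth roots of unity.\<close>
  have "4 * q (T x) y = f 1 + f (-1) + f \<i> + f (-\<i>)"
    by (simp add: f_def T' add_left add_right scale_left scale_right algebra_simps)
  then have "4 * cmod (q (T x) y) = cmod (f 1 + f (-1) + f \<i> + f (-\<i>))"
    by (metis norm_mult norm_numeral)
  also have "\<dots> \<le> cmod (f 1) + cmod (f (-1)) + cmod (f \<i>) + cmod (f (-\<i>))"
    by (meson norm_triangle_le add_mono order_refl)
  also have "\<dots> \<le> w * (sqnorm (x + 1 *\<^sub>C y) + sqnorm (x + (-1) *\<^sub>C y)
      + sqnorm (x + \<i> *\<^sub>C y) + sqnorm (x + (-\<i>) *\<^sub>C y))"
    using fle[of 1] fle[of "-1"] fle[of \<i>] fle[of "-\<i>"] by (simp add: distrib_left)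
  also have "\<dots> = w * (4 * sqnorm x + 4 * sqnorm y)"
    by (simp add: sqnorm_add sqnorm_scale scale_left scale_right)
  finally have "cmod (q (T x) y) \<le> w * (sqnorm x + sqnorm y)" by (simp add: algebra_simps)
  moreover have "cmod (q (T x) y) = t * sqnorm (T x)"
    using w by (simp add: y_def scale_right self_eq norm_mult norm_divide sqnorm_nonneg t_def)
  moreover have "sqnorm y = t\<^sup>2 * sqnorm (T x)"
    by (simp add: y_def sqnorm_scale)
  ultimately show ?thesis
    using w by (simp add: t_def field_simps power2_eq_square)
qed

text \<open>Polarization is applied once, to \<open>T ^^ n\<close>, after the power inequality, so
  the factor 4 does not grow with \<open>n\<close>. Iterating the estimate for \<open>T\<close>
  would only give growth at rate \<open>2 * w\<close>.\<close>

lemma sqnorm_funpow_le: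
  assumes "complex_linear T" "0 < w" "\<And>y. cmod (q (T y) y) \<le> w * sqnorm y"
  shows "sqnorm ((T ^^ n) x) \<le> 4 * (w ^ n)\<^sup>2 * sqnorm x"
  using assms
  by (intro sqnorm_le_of_numerical_bound complex_linear_funpow power_inequality) auto

end

section \<open>The form of a positive operator\<close>

lemma psd_form_A_inner:
  assumes "positive_op A"
  shows "psd_form (A_inner A)"
proof -
  interpret A: bounded_linear A
    using assms by (simp add: positive_op_def bounded_clinear_def)
  have sc: "A (c *\<^sub>C x) = c *\<^sub>C A x" for c x
    using assms by (simp add: positive_op_def bounded_clinear_def)
  have ar: "cinner x (y + z) = cinner x y + cinner x z" for x y z :: 'a
    by (metis cinner_commute cinner_add_left complex_cnj_add)
  have sr: "cinner x (c *\<^sub>C y) = cnj c * cinner x y" for x y :: 'a and c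
    by (metis cinner_commute cinner_scaleC_left complex_cnj_mult)
  show ?thesis
    using assms
    by unfold_locales
      (simp_all add: A_inner_def positive_op_def A.add sc ar sr cinner_add_left cinner_scaleC_left)
qed

lemma complex_linear_A_bounded: "T \<in> A_bounded_ops A \<Longrightarrow> complex_linear T"
  by (simp add: A_bounded_ops_def bounded_clinear_def complex_linear_def
      bounded_linear.linear linear_add)

lemma A_bounded_opsE:
  assumes "T \<in> A_bounded_ops A"
  obtains l where "l > 0" "\<And>x. A_norm A (T x) \<le> l * A_norm A x"
  using assms by (auto simp: A_bounded_ops_def)

lemma A_bounded_ops_comp:
  assumes "S \<in> A_bounded_ops A" "T \<in> A_bounded_ops A"
  shows "S \<circ> T \<in> A_bounded_ops A"
proof -
  obtain l where l: "l > 0" "\<And>x. A_norm A (S x) \<le> l * A_norm A x"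
    using assms(1) by (rule A_bounded_opsE) blast
  obtain m where m: "m > 0" "\<And>x. A_norm A (T x) \<le> m * A_norm A x"
    using assms(2) by (rule A_bounded_opsE) blast
  have "A_norm A (S (T x)) \<le> l * m * A_norm A x" for x
    using order_trans[OF l(2)[of "T x"] mult_left_mono[OF m(2)[of x], of l]] l(1)
    by (simp add: mult.assoc)
  moreover have "bounded_clinear (S \<circ> T)"
    using assms
    by (auto simp: A_bounded_ops_def bounded_clinear_def comp_def intro: bounded_linear_compose)
  ultimately show ?thesis
    using l(1) m(1) by (auto simp: A_bounded_ops_def intro!: exI[of _ "l * m"])
qed

section \<open>Operator seminorm, numerical radius and spectral radius\<close>

context
  fixes A :: "'a::complex_inner \<Rightarrow> 'a"
  assumes A: "positive_op A"
begin

interpretation psd_form "A_inner A"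
  using A by (rule psd_form_A_inner)

lemma A_norm_eq: "A_norm A x = sqrt (sqnorm x)"
  by (simp add: A_norm_def sqnorm_def)

lemma A_norm_nonneg: "0 \<le> A_norm A x"
  by (simp add: A_norm_eq sqnorm_nonneg)

lemma A_norm_scale: "A_norm A (c *\<^sub>C x) = cmod c * A_norm A x"
  by (simp add: A_norm_eq sqnorm_scale real_sqrt_mult)

lemma A_cauchy_schwarz: "cmod (A_inner A x y) \<le> A_norm A x * A_norm A y"
  using cauchy_schwarz_sqrt[of x y] by (simp add: A_norm_eq)

lemma A_norm_normalize:
  assumes "A_norm A x \<noteq> 0"
  shows "A_norm A (complex_of_real (1 / A_norm A x) *\<^sub>C x) = 1"
  using assms A_norm_nonneg[of x] by (simp add: A_norm_scale norm_divide)

lemma bdd_above_A_norm: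
  assumes "\<And>x. A_norm A (T x) \<le> l * A_norm A x"
  shows "bdd_above {A_norm A (T x) | x. A_norm A x = 1}"
proof (intro bdd_aboveI[of _ l])
  fix v assume "v \<in> {A_norm A (T x) | x. A_norm A x = 1}"
  then obtain x where "v = A_norm A (T x)" "A_norm A x = 1" by auto
  then show "v \<le> l" using assms[of x] by simp
qed

lemma cmod_A_inner_le:
  assumes "\<And>x. A_norm A (T x) \<le> l * A_norm A x"
  shows "cmod (A_inner A (T x) x) \<le> l * (A_norm A x)\<^sup>2"
  using A_cauchy_schwarz[of "T x" x] mult_right_mono[OF assms[of x] A_norm_nonneg[of x]]
  by (simp add: power2_eq_square)

lemma bdd_above_A_inner:
  assumes "\<And>x. A_norm A (T x) \<le> l * A_norm A x"
  shows "bdd_above {cmod (A_inner A (T x) x) | x. A_norm A x = 1}"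
proof (intro bdd_aboveI[of _ l])
  fix v assume "v \<in> {cmod (A_inner A (T x) x) | x. A_norm A x = 1}"
  then obtain x where "v = cmod (A_inner A (T x) x)" "A_norm A x = 1" by auto
  then show "v \<le> l" using cmod_A_inner_le[OF assms, of x] by simp
qed

text \<open>The bound makes the real supremum an actual upper bound of the set; without unit vectors
  \<open>Sup0\<close> supplies the value 0.\<close>

lemma A_opnorm_nonneg:
  assumes "\<And>x. A_norm A (T x) \<le> l * A_norm A x"
  shows "0 \<le> A_opnorm A T"
proof (cases "\<exists>x. A_norm A x = 1")
  case True
  then obtain x where x: "A_norm A x = 1" by blast
  have "0 \<le> A_norm A (T x)" by (rule A_norm_nonneg)
  also have "\<dots> \<le> Sup {A_norm A (T x) | x. A_norm A x = 1}"
    using x by (intro cSup_upper bdd_above_A_norm[OF assms]) auto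
  finally show ?thesis using x by (auto simp: A_opnorm_def Sup0_def)
qed (auto simp: A_opnorm_def Sup0_def)

lemma A_opnorm_le:
  assumes "0 \<le> l" "\<And>x. A_norm A (T x) \<le> l * A_norm A x"
  shows "A_opnorm A T \<le> l"
proof (cases "\<exists>x. A_norm A x = 1")
  case True
  have "Sup {A_norm A (T x) | x. A_norm A x = 1} \<le> l"
    using True assms(2) by (intro cSup_least) (auto, metis mult.right_neutral)
  then show ?thesis using assms by (auto simp: A_opnorm_def Sup0_def)
qed (use assms in \<open>auto simp: A_opnorm_def Sup0_def\<close>)

text \<open>Normalizing \<open>x\<close> reduces to unit vectors. The supremum does not see vectors
  of seminorm 0, but there \<open>A\<close>-boundedness itself forces
  \<open>A_norm A (T x) = 0\<close>.\<close>

lemma A_norm_le_A_opnorm: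
  assumes T: "T \<in> A_bounded_ops A"
  shows "A_norm A (T x) \<le> A_opnorm A T * A_norm A x"
proof -
  obtain l where l: "\<And>x. A_norm A (T x) \<le> l * A_norm A x"
    using T by (rule A_bounded_opsE) blast
  show ?thesis
  proof (cases "A_norm A x = 0")
    case True
    then show ?thesis using l[of x] by simp
  next
    case False
    define u where "u = complex_of_real (1 / A_norm A x) *\<^sub>C x"
    have u: "A_norm A u = 1" unfolding u_def using False by (rule A_norm_normalize)
    have "A_norm A (T u) \<le> Sup {A_norm A (T x) | x. A_norm A x = 1}"
      using u by (intro cSup_upper bdd_above_A_norm[OF l]) auto
    also have "\<dots> = A_opnorm A T" using u by (auto simp: A_opnorm_def Sup0_def)
    finally show ?thesis
      using False A_norm_nonneg[of x] complex_linear_A_bounded[OF T]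
      by (simp add: u_def complex_linear_def A_norm_scale norm_divide field_simps)
  qed
qed

text \<open>Again by normalization, now quadratic in the scaling factor; for vectors of seminorm 0
  the left side vanishes by Cauchy-Schwarz.\<close>

lemma A_inner_le_A_numerical_radius:
  assumes T: "T \<in> A_bounded_ops A"
  shows "cmod (A_inner A (T x) x) \<le> A_numerical_radius A T * (A_norm A x)\<^sup>2"
proof -
  obtain l where l: "\<And>x. A_norm A (T x) \<le> l * A_norm A x"
    using T by (rule A_bounded_opsE) blast
  show ?thesis
  proof (cases "A_norm A x = 0")
    case True
    then show ?thesis using cmod_A_inner_le[OF l, of x] by simp
  next
    case False
    define u where "u = complex_of_real (1 / A_norm A x) *\<^sub>C x"
    have u: "A_norm A u = 1" unfolding u_def using False by (rule A_norm_normalize)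
    have "cmod (A_inner A (T u) u) \<le> Sup {cmod (A_inner A (T x) x) | x. A_norm A x = 1}"
      using u by (intro cSup_upper bdd_above_A_inner[OF l]) auto
    also have "\<dots> = A_numerical_radius A T" using u by (auto simp: A_numerical_radius_def Sup0_def)
    finally show ?thesis
      using False A_norm_nonneg[of x] complex_linear_A_bounded[OF T]
      by (simp add: u_def complex_linear_def scale_left scale_right norm_mult norm_divide
          field_simps power2_eq_square)
  qed
qed

lemma A_numerical_radius_nonneg:
  assumes T: "T \<in> A_bounded_ops A"
  shows "0 \<le> A_numerical_radius A T"
proof (cases "\<exists>x. A_norm A x = 1")
  case True
  then obtain x where x: "A_norm A x = 1" by blast
  have "cmod (A_inner A (T x) x) \<le> A_numerical_radius A T"
    using A_inner_le_A_numerical_radius[OF T, of x] x by simp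
  then show ?thesis using norm_ge_zero order_trans by blast
qed (auto simp: A_numerical_radius_def Sup0_def)

text \<open>Cauchy-Schwarz on unit vectors; if there are none, both sides are 0 by
  \<open>Sup0\<close>.\<close>

lemma A_numerical_radius_le_A_opnorm:
  assumes T: "T \<in> A_bounded_ops A"
  shows "A_numerical_radius A T \<le> A_opnorm A T"
proof (cases "\<exists>x. A_norm A x = 1")
  case True
  have "cmod (A_inner A (T x) x) \<le> A_opnorm A T" if "A_norm A x = 1" for x
    using cmod_A_inner_le[OF A_norm_le_A_opnorm[OF T], of x] that by simp
  then have "Sup {cmod (A_inner A (T x) x) | x. A_norm A x = 1} \<le> A_opnorm A T"
    using True by (intro cSup_least) auto
  then show ?thesis using True by (auto simp: A_numerical_radius_def Sup0_def)
qed (auto simp: A_opnorm_def A_numerical_radius_def Sup0_def)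

text \<open>The \<open>n\<close>-th root of the constant \<open>K\<close> tends to 1, so only the
  rate \<open>w\<close> survives. The bound starts at \<open>n = 1\<close>, as the infimum does;
  \<open>K\<close> may be less than 1.\<close>

lemma A_spectral_radius_le:
  assumes w: "0 < w" and K: "0 < K"
    and bound: "\<And>n x. 0 < n \<Longrightarrow> A_norm A ((T ^^ n) x) \<le> K * w ^ n * A_norm A x"
  shows "A_spectral_radius A T \<le> w"
proof -
  have nonneg: "0 \<le> root n (A_opnorm A (T ^^ n))" if "n \<in> {1..}" for n
    using that A_opnorm_nonneg[OF bound, of n] by simp
  have le: "A_spectral_radius A T \<le> root n K * w" if "1 \<le> n" for n
  proof -
    have "A_spectral_radius A T \<le> root n (A_opnorm A (T ^^ n))"
      unfolding A_spectral_radius_def using that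
      by (intro cINF_lower bdd_belowI2[of _ 0] nonneg) auto
    also have "\<dots> \<le> root n (K * w ^ n)"
      using that w K by (intro real_root_le_mono A_opnorm_le bound) auto
    also have "\<dots> = root n K * w"
      using that w by (simp add: real_root_mult real_root_power_cancel)
    finally show ?thesis .
  qed
  have "(\<lambda>n. root n K * w) \<longlonglongrightarrow> 1 * w"
    by (intro tendsto_mult tendsto_const LIMSEQ_root_const K)
  then have "A_spectral_radius A T \<le> 1 * w"
    by (rule LIMSEQ_le_const) (use le in auto)
  then show ?thesis by simp
qed

end

section \<open>Block operators\<close>

instantiation prod :: (complex_vector, complex_vector) complex_vector
begin

definition scaleC_prod :: "complex \<Rightarrow> 'a \<times> 'b \<Rightarrow> 'a \<times> 'b"
  where "scaleC_prod c p = (c *\<^sub>C fst p, c *\<^sub>C snd p)"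

instance
  by standard (simp_all add: scaleC_prod_def prod_eq_iff scaleC_add_right scaleC_add_left
      scaleC_scaleC scaleC_one scaleR_scaleC)

end

lemma psd_form_weighted_sum:
  assumes "psd_form q" "0 \<le> c" "0 \<le> b"
  shows "psd_form (\<lambda>p r. complex_of_real c * q (fst p) (fst r) + complex_of_real b * q (snd p) (snd r))"
proof -
  interpret psd_form q by fact
  show ?thesis
    by unfold_locales
      (use assms sqnorm_nonneg in \<open>auto simp: scaleC_prod_def add_left add_right scale_left scale_right
        self_eq complex_nonneg_Reals_iff algebra_simps\<close>)
qed

text \<open>\<open>w\<close> is the larger root of \<open>(w - p) (w - q) = b c\<close>.\<close>

lemma weighted_quadratic_form_le:
  fixes p q b c X Y :: real
  assumes "0 < b" "0 < c"
    and w: "w = 1 / 2 * (p + q + sqrt ((p - q)\<^sup>2 + 4 * b * c))"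
  shows "c * (p * X\<^sup>2 + b * X * Y) + b * (c * X * Y + q * Y\<^sup>2) \<le> w * (c * X\<^sup>2 + b * Y\<^sup>2)"
proof -
  define s where "s = sqrt ((p - q)\<^sup>2 + 4 * b * c)"
  have s2: "s\<^sup>2 = (p - q)\<^sup>2 + 4 * b * c"
    using assms by (simp add: s_def)
  \<comment> \<open>Strictness comes from \<open>b * c > 0\<close> and gives
    \<open>w - p > 0\<close>, by which the final inequality is divided.\<close>
  have "\<bar>p - q\<bar> < s"
    unfolding s_def using assms by (intro real_less_rsqrt) auto
  then have pos: "0 < w - p" using w by (simp add: s_def)
  have prod: "(w - p) * (w - q) = b * c"
    using s2 unfolding w s_def[symmetric] by (simp add: field_simps power2_eq_square)
  \<comment> \<open>Completing the square: this is \<open>w - p\<close> times the difference of the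
    two sides of the claim, once \<open>b * c\<close> is replaced by
    \<open>(w - p) * (w - q)\<close>.\<close>
  have "0 \<le> c * ((w - p) * X - b * Y)\<^sup>2"
    using assms by simp
  also have "\<dots> = (w - p) * (c * (w - p) * X\<^sup>2 - 2 * b * c * X * Y) + (b * c) * b * Y\<^sup>2"
    by (simp add: algebra_simps power2_eq_square)
  also have "\<dots> = (w - p) * (c * (w - p) * X\<^sup>2 - 2 * b * c * X * Y + b * (w - q) * Y\<^sup>2)"
    by (simp add: algebra_simps flip: prod)
  finally have "0 \<le> c * (w - p) * X\<^sup>2 - 2 * b * c * X * Y + b * (w - q) * Y\<^sup>2"
    using pos by (simp add: zero_le_mult_iff)
  then show ?thesis by (simp add: algebra_simps)
qed

text \<open>The function \<open>sqrt (a\<^sup>2 + d)\<close> is 1-Lipschitz in \<open>a\<close>, so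
  raising \<open>p\<close> or \<open>q\<close> lowers the root by no more than it adds to the sum.
  The two variables are moved one after the other.\<close>

lemma larger_root_mono:
  fixes p q p' q' d :: real
  assumes "p \<le> p'" "q \<le> q'" "0 \<le> d"
  shows "p + q + sqrt ((p - q)\<^sup>2 + d) \<le> p' + q' + sqrt ((p' - q')\<^sup>2 + d)"
proof -
  have step: "sqrt ((a - e)\<^sup>2 + d) \<le> sqrt (a\<^sup>2 + d) + e" if "0 \<le> e" for a e :: real
  proof (rule real_le_lsqrt)
    define s where "s = sqrt (a\<^sup>2 + d)"
    have s: "s\<^sup>2 = a\<^sup>2 + d" "\<bar>a\<bar> \<le> s"
      using assms by (auto simp: s_def intro: real_le_rsqrt)
    have "0 \<le> 2 * (s + a) * e" using that s by simp
    then show "(a - e)\<^sup>2 + d \<le> (sqrt (a\<^sup>2 + d) + e)\<^sup>2"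
      using s(1) unfolding s_def[symmetric] by (simp add: power2_eq_square algebra_simps)
    show "0 \<le> sqrt (a\<^sup>2 + d) + e" using that assms by simp
  qed
  have "sqrt ((p - q)\<^sup>2 + d) \<le> sqrt ((p' - q)\<^sup>2 + d) + (p' - p)"
    using step[of "p' - p" "p' - q"] assms by simp
  moreover have "sqrt ((q - p')\<^sup>2 + d) \<le> sqrt ((q' - p')\<^sup>2 + d) + (q' - q)"
    using step[of "q' - q" "q' - p'"] assms by simp
  ultimately show ?thesis by (simp add: power2_commute)
qed

section \<open>The block estimate and its limiting case\<close>

text \<open>Positive bounds \<open>b\<close> and \<open>c\<close> replace the two norms, which may
  vanish: with a zero weight the form on pairs would lose a component and no longer control
  \<open>R\<close>.\<close>

lemma A_spectral_radius_le_larger_root: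
  fixes A T1 T2 S1 S2 :: "'a::complex_inner \<Rightarrow> 'a"
  assumes A: "positive_op A"
    and ops: "T1 \<in> A_bounded_ops A" "T2 \<in> A_bounded_ops A"
      "S1 \<in> A_bounded_ops A" "S2 \<in> A_bounded_ops A"
    and b: "0 < b" "A_opnorm A (S1 \<circ> T2) \<le> b"
    and c: "0 < c" "A_opnorm A (S2 \<circ> T1) \<le> c"
    and w: "w = 1 / 2 * (A_numerical_radius A (S1 \<circ> T1) + A_numerical_radius A (S2 \<circ> T2)
      + sqrt ((A_numerical_radius A (S1 \<circ> T1) - A_numerical_radius A (S2 \<circ> T2))\<^sup>2 + 4 * b * c))"
    and "0 < w"
  shows "A_spectral_radius A (\<lambda>x. T1 (S1 x) + T2 (S2 x)) \<le> w"
proof -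
  interpret A: psd_form "A_inner A" by (rule psd_form_A_inner[OF A])
  \<comment> \<open>The first component is weighted by the bound for \<open>S2 T1\<close>, the
    second by the bound for \<open>S1 T2\<close>; both off-diagonal terms then become
    \<open>b * c * X * Y\<close>.\<close>
  define Q where "Q = (\<lambda>p r. complex_of_real c * A_inner A (fst p) (fst r)
    + complex_of_real b * A_inner A (snd p) (snd r))"
  interpret Q: psd_form Q
    unfolding Q_def using b c by (intro psd_form_weighted_sum A.psd_form_axioms) auto
  have sq: "A.sqnorm x = (A_norm A x)\<^sup>2" for x
    by (simp add: A_norm_eq[OF A] A.sqnorm_nonneg)
  have Qsq: "Q.sqnorm p = c * (A_norm A (fst p))\<^sup>2 + b * (A_norm A (snd p))\<^sup>2" for p
    unfolding Q.sqnorm_def by (simp add: Q_def A.self_eq sq)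
  define C where "C x = (S1 x, S2 x)" for x
  define R where "R p = T1 (fst p) + T2 (snd p)" for p
  define M where "M p = C (R p)" for p
  define T where "T x = R (C x)" for x
  have T: "T = (\<lambda>x. T1 (S1 x) + T2 (S2 x))"
    by (simp add: T_def R_def C_def fun_eq_iff)
  have lin: "U (x + y) = U x + U y" "U (k *\<^sub>C x) = k *\<^sub>C U x" if "U \<in> {T1, T2, S1, S2}" for U x y k
    using that ops complex_linear_A_bounded[of U A] by (auto simp: complex_linear_def)
  have linM: "complex_linear M"
    by (simp add: complex_linear_def M_def C_def R_def lin scaleC_prod_def scaleC_add_right
        prod_eq_iff algebra_simps)
  \<comment> \<open>The rows of \<open>M\<close> are \<open>S1 T1\<close>, \<open>S1 T2\<close> and
    \<open>S2 T1\<close>, \<open>S2 T2\<close>. Diagonal blocks are estimated by numerical radii,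
    off-diagonal ones by Cauchy-Schwarz and \<open>b\<close>, \<open>c\<close>.\<close>
  have numM: "cmod (Q (M p) p) \<le> w * Q.sqnorm p" for p
  proof -
    obtain x y where p: "p = (x, y)" by fastforce
    define X Y where "X = A_norm A x" and "Y = A_norm A y"
    note nn = A_norm_nonneg[OF A]
    have off: "cmod (A_inner A (U u) v) \<le> k * A_norm A u * A_norm A v"
      if "U \<in> A_bounded_ops A" "A_opnorm A U \<le> k" for U u v k
    proof -
      have "cmod (A_inner A (U u) v) \<le> A_norm A (U u) * A_norm A v"
        by (rule A_cauchy_schwarz[OF A])
      also have "\<dots> \<le> (A_opnorm A U * A_norm A u) * A_norm A v"
        by (intro mult_right_mono A_norm_le_A_opnorm[OF A] that nn)
      also have "\<dots> \<le> k * A_norm A u * A_norm A v"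
        by (intro mult_right_mono that nn)
      finally show ?thesis .
    qed
    let ?p = "A_numerical_radius A (S1 \<circ> T1)" and ?q = "A_numerical_radius A (S2 \<circ> T2)"
    have 11: "cmod (A_inner A (S1 (T1 x)) x) \<le> ?p * X\<^sup>2"
      using A_inner_le_A_numerical_radius[OF A A_bounded_ops_comp[OF ops(3,1)], of x] by (simp add: X_def)
    have 22: "cmod (A_inner A (S2 (T2 y)) y) \<le> ?q * Y\<^sup>2"
      using A_inner_le_A_numerical_radius[OF A A_bounded_ops_comp[OF ops(4,2)], of y] by (simp add: Y_def)
    have 12: "cmod (A_inner A (S1 (T2 y)) x) \<le> b * X * Y"
      using off[OF A_bounded_ops_comp[OF ops(3,2)] b(2), of y x] by (simp add: X_def Y_def mult_ac)
    have 21: "cmod (A_inner A (S2 (T1 x)) y) \<le> c * X * Y"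
      using off[OF A_bounded_ops_comp[OF ops(4,1)] c(2), of x y] by (simp add: X_def Y_def mult_ac)
    have "Q (M p) p = complex_of_real c * (A_inner A (S1 (T1 x)) x + A_inner A (S1 (T2 y)) x)
        + complex_of_real b * (A_inner A (S2 (T1 x)) y + A_inner A (S2 (T2 y)) y)"
      by (simp add: Q_def p M_def C_def R_def lin A.add_left)
    also have "cmod \<dots> \<le> c * cmod (A_inner A (S1 (T1 x)) x + A_inner A (S1 (T2 y)) x)
        + b * cmod (A_inner A (S2 (T1 x)) y + A_inner A (S2 (T2 y)) y)"
      using b c by (intro norm_triangle_le) (simp add: norm_mult)
    also have "\<dots> \<le> c * (?p * X\<^sup>2 + b * X * Y) + b * (c * X * Y + ?q * Y\<^sup>2)"
      using b c by (intro add_mono mult_left_mono norm_triangle_le 11 22 12 21) auto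
    also have "\<dots> \<le> w * (c * X\<^sup>2 + b * Y\<^sup>2)"
      using b(1) c(1) w by (rule weighted_quadratic_form_le)
    finally show ?thesis by (simp add: Qsq p X_def Y_def)
  qed
  have ex: "\<exists>k>0. \<forall>x. (A_norm A (U x))\<^sup>2 \<le> k * (A_norm A x)\<^sup>2" if U: "U \<in> A_bounded_ops A" for U
  proof -
    obtain l where "l > 0" and l: "\<And>x. A_norm A (U x) \<le> l * A_norm A x"
      using U by (rule A_bounded_opsE) blast
    have "(A_norm A (U x))\<^sup>2 \<le> l\<^sup>2 * (A_norm A x)\<^sup>2" for x
      using power_mono[OF l[of x] A_norm_nonneg[OF A], of 2] by (simp add: power_mult_distrib)
    then show ?thesis using \<open>l > 0\<close> by (intro exI[of _ "l\<^sup>2"]) auto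
  qed
  obtain k1 where k1: "k1 > 0" "\<And>x. (A_norm A (T1 x))\<^sup>2 \<le> k1 * (A_norm A x)\<^sup>2" using ex[OF ops(1)] by blast
  obtain k2 where k2: "k2 > 0" "\<And>x. (A_norm A (T2 x))\<^sup>2 \<le> k2 * (A_norm A x)\<^sup>2" using ex[OF ops(2)] by blast
  obtain k3 where k3: "k3 > 0" "\<And>x. (A_norm A (S1 x))\<^sup>2 \<le> k3 * (A_norm A x)\<^sup>2" using ex[OF ops(3)] by blast
  obtain k4 where k4: "k4 > 0" "\<And>x. (A_norm A (S2 x))\<^sup>2 \<le> k4 * (A_norm A x)\<^sup>2" using ex[OF ops(4)] by blast
  \<comment> \<open>\<open>L\<close> bounds \<open>C\<close> into the weighted form, and
    \<open>N\<close> below bounds \<open>R\<close> out of it. In \<open>N\<close> the factor 2 stems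
    from \<open>sqnorm_add_le\<close>, and the divisions undo the weights.\<close>
  define L where "L = c * k3 + b * k4"
  have L: "L > 0" "Q.sqnorm (C x) \<le> L * (A_norm A x)\<^sup>2" for x
    using add_mono[OF mult_left_mono[OF k3(2)[of x], of c] mult_left_mono[OF k4(2)[of x], of b]]
      k3(1) k4(1) b(1) c(1)
    by (auto simp: L_def Qsq C_def algebra_simps intro: add_pos_pos)
  define N where "N = 2 * k1 / c + 2 * k2 / b"
  have N0: "N > 0" using k1(1) k2(1) b(1) c(1) by (simp add: N_def add_pos_pos)
  have N: "(A_norm A (R p))\<^sup>2 \<le> N * Q.sqnorm p" for p
  proof -
    have "(A_norm A (R p))\<^sup>2 \<le> 2 * (A_norm A (T1 (fst p)))\<^sup>2 + 2 * (A_norm A (T2 (snd p)))\<^sup>2"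
      using A.sqnorm_add_le by (simp add: R_def flip: sq)
    also have "\<dots> \<le> 2 * (k1 * (A_norm A (fst p))\<^sup>2) + 2 * (k2 * (A_norm A (snd p))\<^sup>2)"
      using k1(2) k2(2) by (intro add_mono mult_left_mono) auto
    also have "\<dots> = 2 * k1 / c * (c * (A_norm A (fst p))\<^sup>2) + 2 * k2 / b * (b * (A_norm A (snd p))\<^sup>2)"
      using b(1) c(1) by simp
    also have "\<dots> \<le> N * Q.sqnorm p"
      using b(1) c(1) k1(1) k2(1) unfolding Qsq N_def by (simp add: algebra_simps)
    finally show ?thesis .
  qed
  \<comment> \<open>Intertwining: \<open>M\<close> after \<open>C\<close> and \<open>C\<close> after
    \<open>T\<close> are both \<open>C R C\<close>.\<close>
  have MC: "(M ^^ n) (C x) = C ((T ^^ n) x)" for n x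
    by (induction n) (simp_all add: M_def T_def)
  \<comment> \<open>For \<open>n = Suc m\<close> the power of \<open>T\<close> is \<open>R\<close>,
    \<open>M ^^ m\<close>, \<open>C\<close> composed, which yields only \<open>w ^ m\<close>;
    dividing by \<open>w\<close> supplies the missing factor. The 2 is the root of the 4 in
    \<open>sqnorm_funpow_le\<close>.\<close>
  define K where "K = 2 * sqrt (N * L) / w"
  have "A_norm A ((T ^^ n) x) \<le> K * w ^ n * A_norm A x" if "0 < n" for n x
  proof -
    obtain m where n: "n = Suc m" using \<open>0 < n\<close> gr0_conv_Suc by auto
    have "(A_norm A ((T ^^ n) x))\<^sup>2 = (A_norm A (R ((M ^^ m) (C x))))\<^sup>2"
      by (simp add: n MC T_def)
    also have "\<dots> \<le> N * Q.sqnorm ((M ^^ m) (C x))" by (rule N)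
    also have "\<dots> \<le> N * (4 * (w ^ m)\<^sup>2 * Q.sqnorm (C x))"
      using N0 by (intro mult_left_mono Q.sqnorm_funpow_le linM \<open>0 < w\<close> numM) auto
    also have "\<dots> \<le> N * (4 * (w ^ m)\<^sup>2 * (L * (A_norm A x)\<^sup>2))"
      using N0 by (intro mult_left_mono L) auto
    also have "\<dots> = (K * w ^ n * A_norm A x)\<^sup>2"
      using N0 L(1) \<open>0 < w\<close> by (simp add: K_def n power_mult_distrib power_divide)
    finally show ?thesis
      by (rule power2_le_imp_le) (use N0 L(1) \<open>0 < w\<close> A_norm_nonneg[OF A] in \<open>simp add: K_def\<close>)
  qed
  moreover have "0 < K" using N0 L(1) \<open>0 < w\<close> by (simp add: K_def)
  ultimately show ?thesis
    using A_spectral_radius_le[OF A \<open>0 < w\<close>] unfolding T[symmetric] by blast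
qed

theorem theorem2p4:
  fixes A T1 T2 S1 S2 :: "'a::chilbert_space \<Rightarrow> 'a" and a1 a2 :: real
  assumes "positive_op A"
    and "T1 \<in> A_bounded_ops A" and "T2 \<in> A_bounded_ops A"
    and "S1 \<in> A_bounded_ops A" and "S2 \<in> A_bounded_ops A"
    and "a2 = 1 / 2 * (A_numerical_radius A (S1 \<circ> T1) + A_numerical_radius A (S2 \<circ> T2)
      + sqrt ((A_numerical_radius A (S1 \<circ> T1) - A_numerical_radius A (S2 \<circ> T2))\<^sup>2
          + 4 * A_opnorm A (S1 \<circ> T2) * A_opnorm A (S2 \<circ> T1)))"
    and "a1 = 1 / 2 * (A_opnorm A (S1 \<circ> T1) + A_opnorm A (S2 \<circ> T2)
      + sqrt ((A_opnorm A (S1 \<circ> T1) - A_opnorm A (S2 \<circ> T2))\<^sup>2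
          + 4 * A_opnorm A (S1 \<circ> T2) * A_opnorm A (S2 \<circ> T1)))"
  shows "A_spectral_radius A (\<lambda>x. T1 (S1 x) + T2 (S2 x)) \<le> a2 \<and> a2 \<le> a1"
proof
  let ?p = "A_numerical_radius A (S1 \<circ> T1)" and ?q = "A_numerical_radius A (S2 \<circ> T2)"
  let ?b = "A_opnorm A (S1 \<circ> T2)" and ?c = "A_opnorm A (S2 \<circ> T1)"
  have bc: "0 \<le> ?b" "0 \<le> ?c"
    using assms(1-5) by (auto intro!: A_opnorm_nonneg A_norm_le_A_opnorm A_bounded_ops_comp)
  have pq: "0 \<le> ?p" "0 \<le> ?q"
    using assms(1-5) by (auto intro!: A_numerical_radius_nonneg A_bounded_ops_comp)
  \<comment> \<open>Both norms are enlarged by \<open>e > 0\<close> to obtain positive bounds;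
    \<open>f 0\<close> is \<open>a2\<close>.\<close>
  define f where "f e = 1 / 2 * (?p + ?q + sqrt ((?p - ?q)\<^sup>2 + 4 * (?b + e) * (?c + e)))" for e
  have "A_spectral_radius A (\<lambda>x. T1 (S1 x) + T2 (S2 x)) \<le> f e" if "0 < e" for e
  proof (rule A_spectral_radius_le_larger_root[OF assms(1-5)])
    show "0 < ?b + e" "0 < ?c + e" using bc that by auto
    then have "0 < sqrt ((?p - ?q)\<^sup>2 + 4 * (?b + e) * (?c + e))"
      by (simp add: add_nonneg_pos)
    then show "0 < f e" using pq unfolding f_def by (intro mult_pos_pos add_nonneg_pos) auto
  qed (use that in \<open>auto simp: f_def\<close>)
  \<comment> \<open>The bound passes to the limit because \<open>f\<close> is continuous at 0 from
    the right.\<close>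
  then have "\<forall>\<^sub>F e in at_right 0. A_spectral_radius A (\<lambda>x. T1 (S1 x) + T2 (S2 x)) \<le> f e"
    by (simp add: eventually_at_filter)
  moreover have "(f \<longlongrightarrow> f 0) (at_right 0)"
    unfolding f_def by (intro tendsto_intros)
  ultimately have "A_spectral_radius A (\<lambda>x. T1 (S1 x) + T2 (S2 x)) \<le> f 0"
    by (intro tendsto_lowerbound) auto
  then show "A_spectral_radius A (\<lambda>x. T1 (S1 x) + T2 (S2 x)) \<le> a2"
    using assms(6) by (simp add: f_def)
  \<comment> \<open>The product of the off-diagonal norms is the common \<open>d\<close> of
    \<open>larger_root_mono\<close>; only the diagonal entries grow.\<close>
  show "a2 \<le> a1"
    unfolding assms(6,7) using assms(1-5) bc
    by (intro mult_left_mono larger_root_mono A_numerical_radius_le_A_opnorm A_bounded_ops_comp) auto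
qed

end
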